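(* Let $A,B$ be rational numbers and set $a=2A+\frac{3p}{4}$, $b=2B+\frac{p}{4}$, $p=4(A+B)$ (equivalently $a=5A+3B$, $b=A+3B$, $p=4A+4B$), where $a,b,p$ are positive. Let $|q|<1$, $q\neq 0$, where either $q\in(0,1)$, or $A,B$ are integers and $q$ is complex. Assume that $[b,p;q]\neq 0$, so that the quantities below are defined. Then $$R^{*}(a,b,p;q)=(1-q^{B-A})\,P(q^{A},q^{B},q^{A+B}).$$
   Context: For $|q|<1$ let $(x;q)_\infty=\prod_{n=0}^{\infty}(1-xq^{n})$. Define $[a,p;q]=(q^{p-a};q^{p})_\infty\,(q^{a};q^{p})_\infty$ and $R^{*}(a,b,p;q)=\dfrac{[a,p;q]}{[b,p;q]}$. For $|\alpha\beta|<1$ and $|q|<1$ define $$P(\alpha,\beta,q):=\frac{(\alpha^{2}q^{3};q^{4})_\infty\,(\beta^{2}q^{3};q^{4})_\infty}{(\alpha^{2}q;q^{4})_\infty\,(\beta^{2}q;q^{4})_\infty}.$$ (It is a known result, recalled from the literature, that $P(\alpha,\beta,q)$ equals the continued fraction $\frac{1}{(1-\alpha\beta)+}\frac{(\alpha-\beta q)(\beta-\alpha q)}{(1-\alpha\beta)(q^2+1)+}\frac{(\alpha-\beta q^3)(\beta-\alpha q^3)}{(1-\alpha\beta)(q^4+1)+}\frac{(\alpha-\beta q^5)(\beta-\alpha q^5)}{(1-\alpha\beta)(q^6+1)+\cdots}$.) *)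

theory Defs
  imports "HOL-Analysis.Analysis"
begin

definition qpoch_inf :: "complex \<Rightarrow> complex \<Rightarrow> complex" where
  "qpoch_inf x q = (\<Prod>n. 1 - x * q ^ n)"

(* Powers with rational exponents use the principal complex power. It is the ordinary real power
   for a base in (0,1) and the ordinary integer power for an integer exponent and a nonzero base,
   as the next two facts record; it is not used here in any other case. *)

lemma powr_of_rat_real:
  fixes t :: real and r :: rat
  assumes "0 < t"
  shows "complex_of_real t powr of_rat r = complex_of_real (t powr of_rat r)"
proof -
  have "(of_rat r :: complex) = complex_of_real (of_rat r)"
    by (cases r) (simp add: of_rat_rat)
  then show ?thesis
    using assms by (simp add: powr_of_real)
qed

lemma powr_of_rat_int:
  fixes q :: complex and m :: int
  assumes "q \<noteq> 0"
  shows "q powr of_rat (of_int m) = q powi m"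
  using assms by (simp add: powr_of_int power_int_def power_inverse)

definition qbracket :: "rat \<Rightarrow> rat \<Rightarrow> complex \<Rightarrow> complex" where
  "qbracket a p q =
     qpoch_inf (q powr of_rat (p - a)) (q powr of_rat p) *
     qpoch_inf (q powr of_rat a) (q powr of_rat p)"

definition Rstar :: "rat \<Rightarrow> rat \<Rightarrow> rat \<Rightarrow> complex \<Rightarrow> complex" where
  "Rstar a b p q = qbracket a p q / qbracket b p q"

definition Pquot :: "complex \<Rightarrow> complex \<Rightarrow> complex \<Rightarrow> complex" where
  "Pquot \<alpha> \<beta> q =
     (qpoch_inf (\<alpha>\<^sup>2 * q ^ 3) (q ^ 4) * qpoch_inf (\<beta>\<^sup>2 * q ^ 3) (q ^ 4)) /
     (qpoch_inf (\<alpha>\<^sup>2 * q) (q ^ 4) * qpoch_inf (\<beta>\<^sup>2 * q) (q ^ 4))"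

end

theory Submission imports Defs begin

text \<open>Substituting \<open>a = 5 * A + 3 * B\<close>, \<open>b = A + 3 * B\<close>,
  \<open>p = 4 * (A + B)\<close> turns every infinite product on both sides into one with base q^p.
  The two denominators agree, since p - b = 3A + B. In the numerators, q^a = q^(5A+3B) is shared,
  and the only mismatch is q^(B-A) in \<open>qbracket a p q\<close> against q^(3A+5B) in
  \<open>Pquot\<close>. These differ by one factor q^p, so splitting off the first factor with
  \<open>qpoch_inf_Suc\<close> produces exactly 1 - q^(B-A).\<close>

lemma convergent_prod_qpoch_inf:
  fixes x q :: complex
  assumes "norm q < 1"
  shows "convergent_prod (\<lambda>n. 1 - x * q ^ n)"
proof -
  have "summable (\<lambda>n. norm x * norm q ^ n)"
    using assms by (intro summable_mult summable_geometric) simp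
  then have "abs_convergent_prod (\<lambda>n. 1 + (- x * q ^ n))"
    by (intro summable_imp_abs_convergent_prod) (simp add: norm_mult norm_power)
  then show ?thesis
    by (simp add: abs_convergent_prod_imp_convergent_prod)
qed

lemma qpoch_inf_Suc:
  assumes "norm q < 1"
  shows "qpoch_inf x q = (1 - x) * qpoch_inf (x * q) q"
proof -
  have "(\<lambda>n. 1 - x * q * q ^ n) has_prod qpoch_inf (x * q) q"
    unfolding qpoch_inf_def using assms
    by (intro convergent_prod_has_prod convergent_prod_qpoch_inf)
  then have shift: "(\<lambda>n. 1 - x * q ^ Suc n) has_prod qpoch_inf (x * q) q"
    by (simp add: mult.assoc)
  have all: "(\<lambda>n. 1 - x * q ^ n) has_prod qpoch_inf x q"
    unfolding qpoch_inf_def using assms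
    by (intro convergent_prod_has_prod convergent_prod_qpoch_inf)
  show ?thesis
  \<comment> \<open>\<open>has_prod_Suc_iff\<close> needs a nonzero first factor, so x = 1, where
    both sides vanish, is treated apart.\<close>
  proof (cases "x = 1")
    case True
    then have "qpoch_inf x q = 0"
      using all by (auto simp: has_prod_eq_0_iff intro: range_eqI[where x = 0])
    with True show ?thesis by simp
  next
    case False
    then have "(\<lambda>n. 1 - x * q ^ n) has_prod (qpoch_inf (x * q) q * (1 - x))"
      using shift by (subst (asm) has_prod_Suc_iff) auto
    with all show ?thesis
      by (simp add: has_prod_unique2 mult.commute)
  qed
qed

theorem theorem6:
  fixes A B a b p :: rat and q :: complex
  assumes "a = 2 * A + 3 * p / 4"
    and "b = 2 * B + p / 4"
    and "p = 4 * (A + B)"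
    and "a > 0" and "b > 0" and "p > 0"
    and "norm q < 1" and "q \<noteq> 0"
    and "(\<exists>t::real. 0 < t \<and> t < 1 \<and> q = complex_of_real t) \<or> (A \<in> \<int> \<and> B \<in> \<int>)"
    and "qbracket b p q \<noteq> 0"
  shows "Rstar a b p q =
    (1 - q powr of_rat (B - A)) *
      Pquot (q powr of_rat A) (q powr of_rat B) (q powr of_rat (A + B))"
proof -
  define e :: "rat \<Rightarrow> complex" where "e r = q powr of_rat r" for r
  \<comment> \<open>With one fixed base, the principal power obeys the exponent law with no branch
    correction, so real and complex q are handled alike.\<close>
  have add: "e r * e s = e (r + s)" for r s
    by (simp add: e_def of_rat_add powr_add)
  have pow: "e r ^ n = e (of_nat n * r)" for r n
    using \<open>q \<noteq> 0\<close> by (induction n) (simp_all add: e_def add[unfolded e_def] algebra_simps)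
  \<comment> \<open>A real exponent makes the norm of the power depend on \<open>norm q\<close>
    alone, which gives |q^p| < 1.\<close>
  have "(of_rat p :: complex) = complex_of_real (of_rat p)"
    by (cases p) (simp add: of_rat_rat)
  then have "norm (e p) = norm q powr of_rat p"
    using \<open>q \<noteq> 0\<close> by (simp add: e_def norm_powr_real_powr')
  also have "\<dots> < 1"
    using \<open>norm q < 1\<close> \<open>q \<noteq> 0\<close> \<open>p > 0\<close> powr_less_mono2[of "of_rat p" "norm q" 1] by simp
  finally have "norm (e p) < 1" .
  then have "qpoch_inf (e (p - a)) (e p) = (1 - e (p - a)) * qpoch_inf (e (p - a) * e p) (e p)"
    by (rule qpoch_inf_Suc)
  moreover have "a = 5 * A + 3 * B" "b = A + 3 * B" "p = 4 * A + 4 * B"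
    using assms(1-3) by (simp_all add: field_simps)
  \<comment> \<open>By \<open>add\<close> and \<open>pow\<close>, each identity reduces to equating
    linear forms in A and B; for instance, (B - A) + p = 2B + 3(A + B).\<close>
  then have "p - a = B - A" "e (p - a) * e p = (e B)\<^sup>2 * e (A + B) ^ 3"
    "e a = (e A)\<^sup>2 * e (A + B) ^ 3" "e (p - b) = (e A)\<^sup>2 * e (A + B)"
    "e b = (e B)\<^sup>2 * e (A + B)" "e p = e (A + B) ^ 4"
    unfolding add pow by (simp_all add: algebra_simps)
  ultimately show ?thesis
    unfolding Rstar_def qbracket_def Pquot_def e_def[symmetric] by simp
qed

end
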